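(* Let $\phi\bullet\psi$ be a product or skew-product dynamical system on $X\times Y$ with base system $\psi$ on $Y$, where $X,Y$ are compact metric spaces, and let $\pi_Y\colon X\times Y\to Y$ be the projection. If $N$ is an attracting neighborhood for $\phi\bullet\psi$ with corresponding attractor $A=\omega(N)$, then $\pi_Y(N)$ is an attracting neighborhood for $\psi$ with corresponding attractor $\pi_Y(A)$, i.e. $\omega_\psi(\pi_Y(N))=\pi_Y(A)$.
   Context: $\mathbb{T}$ is $\mathbb{Z}$ or $\mathbb{R}$, $\mathbb{T}^+$ its nonnegative part. A dynamical system on a compact metric space $Z$ is a continuous map $\theta\colon\mathbb{T}^+\times Z\to Z$ with $\theta(0,z)=z$, $\theta(t,\theta(s,z))=\theta(t+s,z)$ (not assumed injective or surjective). Product system: for dynamical systems $\phi$ on $X$ and $\psi$ on $Y$, $(\phi\times\psi)(t,(x,y))=(\phi(t,x),\psi(t,y))$. Skew-product system: $(\phi\rtimes\psi)(t,(x,y))=(\phi(t,x,y),\psi(t,y))$ where $\psi$ is a dynamical system on $Y$ and $\phi\colon\mathbb{T}^+\times X\times Y\to X$ is continuous with $\phi(0,x,y)=x$ and $\phi(t+s,x,y)=\phi(t,\phi(s,x,y),\psi(s,y))$. $\phi\bullet\psi$ denotes either. $\omega(U)=\bigcap_{t\ge0}\mathrm{cl}(\theta([t,\infty),U))$. $U\subset Z$ is an attracting neighborhood if there is $\tau>0$ with $\theta(t,\mathrm{cl}(U))\subset\mathrm{int}(U)$ for all $t\ge\tau$; its corresponding attractor is $\omega(U)$. *)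

theory Defs
  imports "HOL-Analysis.Analysis"
begin

text \<open>The time set \<open>T\<close> is a subset of the reals, either \<open>\<int>\<close> or all of \<open>\<real>\<close> (\<open>UNIV\<close>); the subspace
  topology on \<open>\<int>\<close> is the discrete one. Evolution maps are total HOL functions, and only their
  values at times in \<open>nonneg_times T\<close> and at points of the underlying topological space matter.\<close>

definition nonneg_times :: "real set \<Rightarrow> real set" where
  "nonneg_times T = {t \<in> T. 0 \<le> t}"

definition dynamical_system :: "real set \<Rightarrow> 'z topology \<Rightarrow> (real \<Rightarrow> 'z \<Rightarrow> 'z) \<Rightarrow> bool" where
  "dynamical_system T Z \<theta> \<longleftrightarrow>
     continuous_map (prod_topology (top_of_set (nonneg_times T)) Z) Z (\<lambda>(t, z). \<theta> t z) \<and>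
     (\<forall>z \<in> topspace Z. \<theta> 0 z = z) \<and>
     (\<forall>t \<in> nonneg_times T. \<forall>s \<in> nonneg_times T. \<forall>z \<in> topspace Z.
        \<theta> t (\<theta> s z) = \<theta> (t + s) z)"

definition product_system ::
    "(real \<Rightarrow> 'x \<Rightarrow> 'x) \<Rightarrow> (real \<Rightarrow> 'y \<Rightarrow> 'y) \<Rightarrow> real \<Rightarrow> 'x \<times> 'y \<Rightarrow> 'x \<times> 'y" where
  "product_system \<phi> \<psi> t = (\<lambda>(x, y). (\<phi> t x, \<psi> t y))"

text \<open>The conditions on the fibre map of a skew-product over the base system \<open>\<psi>\<close>.\<close>

definition skew_fibre_map ::
    "real set \<Rightarrow> 'x topology \<Rightarrow> 'y topology \<Rightarrow> (real \<Rightarrow> 'x \<Rightarrow> 'y \<Rightarrow> 'x) \<Rightarrow> (real \<Rightarrow> 'y \<Rightarrow> 'y) \<Rightarrow> bool" where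
  "skew_fibre_map T X Y \<phi> \<psi> \<longleftrightarrow>
     continuous_map (prod_topology (top_of_set (nonneg_times T)) (prod_topology X Y)) X
       (\<lambda>(t, x, y). \<phi> t x y) \<and>
     (\<forall>x \<in> topspace X. \<forall>y \<in> topspace Y. \<phi> 0 x y = x) \<and>
     (\<forall>t \<in> nonneg_times T. \<forall>s \<in> nonneg_times T. \<forall>x \<in> topspace X. \<forall>y \<in> topspace Y.
        \<phi> (t + s) x y = \<phi> t (\<phi> s x y) (\<psi> s y))"

definition skew_product_system ::
    "(real \<Rightarrow> 'x \<Rightarrow> 'y \<Rightarrow> 'x) \<Rightarrow> (real \<Rightarrow> 'y \<Rightarrow> 'y) \<Rightarrow> real \<Rightarrow> 'x \<times> 'y \<Rightarrow> 'x \<times> 'y" where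
  "skew_product_system \<phi> \<psi> t = (\<lambda>(x, y). (\<phi> t x y, \<psi> t y))"

definition omega_limit :: "real set \<Rightarrow> 'z topology \<Rightarrow> (real \<Rightarrow> 'z \<Rightarrow> 'z) \<Rightarrow> 'z set \<Rightarrow> 'z set" where
  "omega_limit T Z \<theta> U =
     (\<Inter>t \<in> nonneg_times T. Z closure_of (\<Union>s \<in> {s \<in> T. t \<le> s}. \<theta> s ` U))"

definition attracting_neighborhood ::
    "real set \<Rightarrow> 'z topology \<Rightarrow> (real \<Rightarrow> 'z \<Rightarrow> 'z) \<Rightarrow> 'z set \<Rightarrow> bool" where
  "attracting_neighborhood T Z \<theta> U \<longleftrightarrow>
     U \<subseteq> topspace Z \<and>
     (\<exists>\<tau> \<in> T. 0 < \<tau> \<and>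
        (\<forall>t \<in> T. \<tau> \<le> t \<longrightarrow> \<theta> t ` (Z closure_of U) \<subseteq> Z interior_of U))"

end

theory Submission
  imports Defs
begin

text \<open>
  The projection \<open>snd\<close> from \<open>X \<times> Y\<close> to \<open>Y\<close> semiconjugates the product or skew-product system
  to the base system, and it is continuous, open (as is every projection) and closed (because
  \<open>X\<close> is compact). The result holds for every semiconjugacy \<open>f\<close> with these three
  properties whose domain is compact and whose codomain is a \<open>T\<^sub>1\<close> space.

  Such a map commutes with closures and sends interiors into interiors, so a time that
  carries \<open>cl(N)\<close> into \<open>int(N)\<close> also carries \<open>cl(f(N)) = f(cl(N))\<close> into
  \<open>f(int(N)) \<subseteq> int(f(N))\<close>. This gives the attracting neighborhood.

  For the attractors, \<open>\<omega>(N)\<close> is a decreasing intersection of closures of forward tails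
  of \<open>N\<close>, and \<open>f\<close> maps the closure of each tail onto the closure of the corresponding tail of
  \<open>f(N)\<close>. It remains to exchange \<open>f\<close> with the intersection. This is where compactness
  enters again: over a point that lies in the image of every tail closure, the fibre meets these
  closures in a decreasing sequence of nonempty closed sets, and such a sequence has a common
  point.
\<close>

lemma closed_continuous_map_image_closure_of:
  assumes "continuous_map Z Y f" "closed_map Z Y f" "S \<subseteq> topspace Z"
  shows "f ` (Z closure_of S) = Y closure_of (f ` S)"
proof (rule subset_antisym)
  show "f ` (Z closure_of S) \<subseteq> Y closure_of (f ` S)"
    using assms(1) by (rule continuous_map_image_closure_subset)
  show "Y closure_of (f ` S) \<subseteq> f ` (Z closure_of S)"
    using assms(2,3) by (simp add: closed_map_closure_of_image)
qed

text \<open>The image of an intersection is in general smaller than the intersection of the images, since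
  the preimages of a point may vary with the set. Compactness of the fibre
  provides one preimage that serves for all sets.\<close>

lemma image_INT_decseq_closedin:
  fixes C :: "nat \<Rightarrow> 'z set"
  assumes Z: "compact_space Z" and Y: "t1_space Y" and f: "continuous_map Z Y f"
    and C: "\<And>n. closedin Z (C n)" and "decseq C"
  shows "f ` (\<Inter>n. C n) = (\<Inter>n. f ` C n)"
proof (intro subset_antisym subsetI)
  fix y assume y: "y \<in> (\<Inter>n. f ` C n)"
  then obtain z where "z \<in> C 0" "y = f z" by auto
  then have "y \<in> topspace Y"
    using C[of 0] closedin_subset f continuous_map_image_subset_topspace by fastforce
  then have "closedin Y {y}"
    using Y by (simp add: t1_space_closedin_singleton)
  define F where "F n = {z \<in> C n. f z \<in> {y}}" for n
  have "closedin Z (F n)" for n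
    unfolding F_def by (rule closedin_continuous_map_preimage_gen[OF f C \<open>closedin Y {y}\<close>])
  moreover have "F n \<noteq> {}" for n
    using y by (auto simp: F_def)
  moreover have "decseq F"
    using \<open>decseq C\<close> by (fastforce simp: F_def antimono_def)
  ultimately have "(\<Inter>n. F n) \<noteq> {}"
    by (rule compact_space_imp_nest[OF Z])
  then show "y \<in> f ` (\<Inter>n. C n)"
    by (auto simp: F_def)
qed auto

lemma attracting_neighborhood_semiconj_image:
  assumes f: "continuous_map Z Y f" "open_map Z Y f" "closed_map Z Y f"
    and conj: "\<And>t z. t \<in> nonneg_times T \<Longrightarrow> z \<in> topspace Z \<Longrightarrow> f (\<theta> t z) = \<psi> t (f z)"
    and N: "attracting_neighborhood T Z \<theta> N"
  shows "attracting_neighborhood T Y \<psi> (f ` N)"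
proof -
  obtain \<tau> where NZ: "N \<subseteq> topspace Z" and \<tau>: "\<tau> \<in> T" "0 < \<tau>"
    and into: "\<And>t. t \<in> T \<Longrightarrow> \<tau> \<le> t \<Longrightarrow> \<theta> t ` (Z closure_of N) \<subseteq> Z interior_of N"
    using N unfolding attracting_neighborhood_def by blast
  have "\<psi> t ` (Y closure_of (f ` N)) \<subseteq> Y interior_of (f ` N)" if t: "t \<in> T" "\<tau> \<le> t" for t
  proof -
    have "t \<in> nonneg_times T" using t \<tau> by (simp add: nonneg_times_def)
    then have "\<psi> t (f z) = f (\<theta> t z)" if "z \<in> Z closure_of N" for z
      using conj that by (metis in_closure_of)
    then have "\<psi> t ` (Y closure_of (f ` N)) = f ` \<theta> t ` (Z closure_of N)"
      unfolding closed_continuous_map_image_closure_of[OF f(1,3) NZ, symmetric] image_image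
      by (rule image_cong[OF refl])
    also have "\<dots> \<subseteq> f ` (Z interior_of N)"
      using into[OF t] by (rule image_mono)
    also have "\<dots> \<subseteq> Y interior_of (f ` N)"
      using f(2) by (simp add: open_map_interior_of_image_subset)
    finally show ?thesis .
  qed
  moreover have "f ` N \<subseteq> topspace Y"
    using f(1) NZ continuous_map_image_subset_topspace by fastforce
  ultimately show ?thesis
    unfolding attracting_neighborhood_def using \<tau> by blast
qed

text \<open>Times run through a possibly uncountable set, but the tails decrease with time, so the
  natural numbers already determine the intersection. This turns the \<open>\<omega>\<close>-limit into the
  intersection of a sequence.\<close>

lemma omega_limit_eq_INT_nat:
  assumes "\<nat> \<subseteq> T"
  shows "omega_limit T Z \<theta> U =
    (\<Inter>n::nat. Z closure_of (\<Union>s \<in> {s \<in> T. real n \<le> s}. \<theta> s ` U))"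
proof (intro subset_antisym subsetI)
  fix z assume z: "z \<in> (\<Inter>n::nat. Z closure_of (\<Union>s \<in> {s \<in> T. real n \<le> s}. \<theta> s ` U))"
  have "z \<in> Z closure_of (\<Union>s \<in> {s \<in> T. t \<le> s}. \<theta> s ` U)" for t
  proof -
    obtain n where "t \<le> real n" using real_arch_simple by blast
    then have "(\<Union>s \<in> {s \<in> T. real n \<le> s}. \<theta> s ` U) \<subseteq> (\<Union>s \<in> {s \<in> T. t \<le> s}. \<theta> s ` U)"
      by fastforce
    from closure_of_mono[OF this] z show ?thesis by (meson INT_D UNIV_I subsetD)
  qed
  then show "z \<in> omega_limit T Z \<theta> U" by (simp add: omega_limit_def)
next
  fix z assume z: "z \<in> omega_limit T Z \<theta> U"
  have "real n \<in> nonneg_times T" for n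
    using assms by (auto simp: nonneg_times_def)
  then show "z \<in> (\<Inter>n::nat. Z closure_of (\<Union>s \<in> {s \<in> T. real n \<le> s}. \<theta> s ` U))"
    using z unfolding omega_limit_def by blast
qed

lemma omega_limit_semiconj_image:
  assumes T: "\<nat> \<subseteq> T" and Z: "compact_space Z" and Y: "t1_space Y"
    and f: "continuous_map Z Y f" "closed_map Z Y f"
    and \<theta>: "\<And>t z. t \<in> nonneg_times T \<Longrightarrow> z \<in> topspace Z \<Longrightarrow> \<theta> t z \<in> topspace Z"
    and conj: "\<And>t z. t \<in> nonneg_times T \<Longrightarrow> z \<in> topspace Z \<Longrightarrow> f (\<theta> t z) = \<psi> t (f z)"
    and U: "U \<subseteq> topspace Z"
  shows "f ` omega_limit T Z \<theta> U = omega_limit T Y \<psi> (f ` U)"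
proof -
  define F where "F n = (\<Union>s \<in> {s \<in> T. real n \<le> s}. \<theta> s ` U)" for n :: nat
  define G where "G n = (\<Union>s \<in> {s \<in> T. real n \<le> s}. \<psi> s ` f ` U)" for n :: nat
  have times: "s \<in> nonneg_times T" if "s \<in> T" "real n \<le> s" for s and n :: nat
    using that of_nat_0_le_iff[of n] unfolding nonneg_times_def by (auto intro: order_trans)
  have FZ: "F n \<subseteq> topspace Z" for n
    using \<theta> U times by (fastforce simp: F_def)
  have FG: "f ` F n = G n" for n
    unfolding F_def G_def image_UN image_image
    using conj U times by (intro SUP_cong image_cong refl) auto
  have "decseq (\<lambda>n. Z closure_of F n)"
    unfolding antimono_def F_def by (intro allI impI closure_of_mono) fastforce
  then have "f ` (\<Inter>n. Z closure_of F n) = (\<Inter>n. f ` (Z closure_of F n))"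
    by (intro image_INT_decseq_closedin[OF Z Y f(1)]) auto
  also have "\<dots> = (\<Inter>n. Y closure_of G n)"
    by (simp add: closed_continuous_map_image_closure_of[OF f FZ] FG)
  finally show ?thesis
    unfolding omega_limit_eq_INT_nat[OF T] F_def G_def .
qed

lemma dynamical_system_in_topspace:
  assumes "dynamical_system T Z \<theta>" "t \<in> nonneg_times T" "z \<in> topspace Z"
  shows "\<theta> t z \<in> topspace Z"
proof -
  have "continuous_map (prod_topology (top_of_set (nonneg_times T)) Z) Z (\<lambda>(t, z). \<theta> t z)"
    using assms(1) by (simp add: dynamical_system_def)
  from continuous_map_image_subset_topspace[OF this] show ?thesis
    using assms(2,3) by (auto simp: image_subset_iff)
qed

lemma skew_fibre_map_in_topspace:
  assumes "skew_fibre_map T X Y \<phi> \<psi>" "t \<in> nonneg_times T" "x \<in> topspace X" "y \<in> topspace Y"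
  shows "\<phi> t x y \<in> topspace X"
proof -
  have "continuous_map (prod_topology (top_of_set (nonneg_times T)) (prod_topology X Y)) X
      (\<lambda>(t, x, y). \<phi> t x y)"
    using assms(1) by (simp add: skew_fibre_map_def)
  from continuous_map_image_subset_topspace[OF this] show ?thesis
    using assms(2-4) by (auto simp: image_subset_iff)
qed

theorem proposition3p3:
  fixes T :: "real set"
    and MX :: "'x set" and dX :: "'x \<Rightarrow> 'x \<Rightarrow> real" and X :: "'x topology"
    and MY :: "'y set" and dY :: "'y \<Rightarrow> 'y \<Rightarrow> real" and Y :: "'y topology"
    and \<psi> :: "real \<Rightarrow> 'y \<Rightarrow> 'y"
    and \<Theta> :: "real \<Rightarrow> 'x \<times> 'y \<Rightarrow> 'x \<times> 'y"
    and N A :: "('x \<times> 'y) set"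
  assumes "T = \<int> \<or> T = UNIV"
    and "Metric_space MX dX" and "X = Metric_space.mtopology MX dX" and "compact_space X"
    and "Metric_space MY dY" and "Y = Metric_space.mtopology MY dY" and "compact_space Y"
    and "dynamical_system T Y \<psi>"
    and "(\<exists>\<phi>. dynamical_system T X \<phi> \<and> \<Theta> = product_system \<phi> \<psi>) \<or>
         (\<exists>\<phi>. skew_fibre_map T X Y \<phi> \<psi> \<and> \<Theta> = skew_product_system \<phi> \<psi>)"
    and "attracting_neighborhood T (prod_topology X Y) \<Theta> N"
    and "A = omega_limit T (prod_topology X Y) \<Theta> N"
  shows "attracting_neighborhood T Y \<psi> (snd ` N) \<and> omega_limit T Y \<psi> (snd ` N) = snd ` A"
proof
  let ?Z = "prod_topology X Y"
  have T: "\<nat> \<subseteq> T"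
    using assms(1) Nats_subset_Ints by blast
  have Z: "compact_space ?Z"
    using assms(4,7) by (simp add: compact_space_prod_topology)
  have Y: "t1_space Y"
    using assms(5,6) by (simp add: Metric_space.Hausdorff_space_mtopology Hausdorff_imp_t1_space)
  have snd: "continuous_map ?Z Y snd" "open_map ?Z Y snd" "closed_map ?Z Y snd"
    using assms(4) by (simp_all add: continuous_map_snd open_map_snd closed_map_snd)
  have conj: "snd (\<Theta> t z) = \<psi> t (snd z)" for t z
    using assms(9) by (auto simp: product_system_def skew_product_system_def split: prod.splits)
  have \<Theta>: "\<Theta> t z \<in> topspace ?Z" if "t \<in> nonneg_times T" "z \<in> topspace ?Z" for t z
    using assms(9) that dynamical_system_in_topspace[OF assms(8)]
    by (auto simp: product_system_def skew_product_system_def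
        intro: dynamical_system_in_topspace skew_fibre_map_in_topspace)
  show "attracting_neighborhood T Y \<psi> (snd ` N)"
    by (intro attracting_neighborhood_semiconj_image[where f = snd and \<theta> = \<Theta> and \<psi> = \<psi>, OF snd]
        conj assms(10))
  have "N \<subseteq> topspace ?Z"
    using assms(10) by (simp add: attracting_neighborhood_def)
  then have "snd ` omega_limit T ?Z \<Theta> N = omega_limit T Y \<psi> (snd ` N)"
    by (intro omega_limit_semiconj_image[where f = snd and \<theta> = \<Theta> and \<psi> = \<psi>, OF T Z Y snd(1,3)]
        \<Theta> conj)
  then show "omega_limit T Y \<psi> (snd ` N) = snd ` A"
    by (simp add: assms(11))
qed

end
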